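(* Let $(\mathbb{S},\oplus,\otimes,0_{\mathbb{S}},1_{\mathbb{S}},\succeq,d)$ be a metric partially ordered pseudo-semiring and let $(\Omega,\mathcal{F},\perp,\parallel,\mathbb{P})$ be a probability space whose abstract probability measure $\mathbb{P}$ takes values in $\mathbb{S}$. Let $A\in\mathcal{F}$ be any event, and let $\{H_i\}_{i\in I}\subset\mathcal{F}$ be a finite set of pairwise exclusive events, indexed by a set $I$, such that $\bigcup_{i\in I}H_i=\Omega$ and $\mathbb{P}(H_i)\neq 0_{\mathbb{S}}$ for all $i\in I$. For each $i\in I$ let $\mathbb{P}_{H_i}$ be an abstract conditional probability given $H_i$. Then \[ \mathbb{P}(A)=\bigoplus_{i\in I}\mathbb{P}(H_i)\otimes\mathbb{P}_{H_i}(A). \]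
   Context: Metric partially ordered pseudo-semiring: a tuple $(\mathbb{S},\oplus,\otimes,0_{\mathbb{S}},1_{\mathbb{S}},\succeq,d)$ such that (i) $(\mathbb{S},\succeq)$ is a (non-strict) partially ordered set ($a\preceq b$ means $b\succeq a$); (ii) $\oplus,\otimes:\mathbb{S}\times\mathbb{S}\to\mathbb{S}$ are commutative and associative, $0_{\mathbb{S}}$ is an identity for $\oplus$, $1_{\mathbb{S}}$ is an identity for $\otimes$, addition is monotone ($b\succeq c\Rightarrow a\oplus b\succeq a\oplus c$ for all $a$), multiplication by non-negative elements is monotone ($b\succeq c\Rightarrow a\otimes b\succeq a\otimes c$ for all $a\succeq 0_{\mathbb{S}}$), and $a\otimes(b\oplus c)=(a\otimes b)\oplus(a\otimes c)$ for all $a,b,c$; (iii) $(\mathbb{S},d)$ is a metric space such that whenever $a_n\to a$ and $b_n\to b$ in $d$: if $a_n\preceq b_n$ for all $n$ then $a\preceq b$; $a_n\oplus b_n\to a\oplus b$; and $a_n\otimes b_n\to a\otimes b$. Limits in $\mathbb{S}$ are with respect to $d$, and $[0_{\mathbb{S}},1_{\mathbb{S}}]=\{s\in\mathbb{S}:0_{\mathbb{S}}\preceq s\preceq 1_{\mathbb{S}}\}$. Let $(\Omega,\mathcal{F})$ be a measurable space ($\mathcal{F}$ a $\sigma$-algebra on $\Omega$); elements of $\mathcal{F}$ are called events. Exclusivity relation: $A\parallel B$ iff $A\cap B=\emptyset$; then $A,B$ are called mutually exclusive. A countable collection is pairwise exclusive iff every pair of events in it is mutually exclusive; it is mutually exclusive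 iff every event is mutually exclusive with every intersection of the other events; the paper treats these two notions as equivalent (the events are pairwise disjoint). Independence relation: a relation $\perp$ on $\mathcal{F}$ such that for all $A,B,C\in\mathcal{F}$: $\neg(A\perp A)$; $A\perp B\Leftrightarrow B\perp A$; $A\perp\Omega$; $(A\perp C)\wedge(B\perp C)\Rightarrow(A\cup B)\perp C$; $(A\perp C)\wedge(B\perp C)\Rightarrow(A\cap B)\perp C$; $A\perp B\Rightarrow A^{\mathrm{C}}\perp B$ (with $A^{\mathrm{C}}=\Omega\setminus A$). Two events $A,B$ with $A\cap B\neq\emptyset$ are mutually independent iff $A\perp B$; a collection of events is mutually independent iff every event is independent of every intersection of the other events. The pair $(\parallel,\perp)$ is called a complex of conditions. Abstract probability measure: a function $\mathbb{P}:\mathcal{F}\to[0_{\mathbb{S}},1_{\mathbb{S}}]$ such that: $\mathbb{P}(A)\in\mathbb{S}$ and $\mathbb{P}(A)\succeq 0_{\mathbb{S}}$ for all $A\in\mathcal{F}$; $\mathbb{P}(\emptyset)=0_{\mathbb{S}}$; $A\subset B\Rightarrow\mathbb{P}(A)\preceq\mathbb{P}(B)$; for every countable sequence $\{A_i\}\subset\mathcal{F}$ of mutually exclusive events, $\mathbb{P}(\bigcup_{i=1}^{\infty}A_i)=\bigoplus_{i=1}^{\infty}\mathbb{P}(A_i)=\lim_{n\to\infty}\bigoplus_{i=1}^{n}\mathbb{P}(A_i)$; $\mathbb{P}(\Omega)=1_{\mathbb{S}}$; for every countable sequence $\{A_i\}\subset\mathcal{F}$ of mutually independent events, $\mathbb{P}(\bigcap_{i=1}^{\infty}A_i)=\bigotimes_{i=1}^{\infty}\mathbb{P}(A_i)=\lim_{n\to\infty}\bigotimes_{i=1}^{n}\mathbb{P}(A_i)$.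 Probability space: a tuple $(\Omega,\mathcal{F},\perp,\parallel,\mathbb{P})$ consisting of a measurable space with a complex of conditions and an abstract probability measure on it. Abstract conditional probability: for $B\in\mathcal{F}$ with $\mathbb{P}(B)\neq 0_{\mathbb{S}}$, an abstract conditional probability given $B$ is an abstract probability measure $\mathbb{P}_B:\mathcal{F}\to[0_{\mathbb{S}},1_{\mathbb{S}}]$ (on the same measurable space with the same complex of conditions) such that for all $A\in\mathcal{F}$: $A\parallel B\Rightarrow\mathbb{P}_B(A)=0_{\mathbb{S}}$; $A\perp B\Rightarrow\mathbb{P}_B(A)=\mathbb{P}(A)$; $\neg(A\perp B)\Rightarrow\mathbb{P}_B(A)\neq\mathbb{P}(A)$; $\mathbb{P}(A\cap B)=\mathbb{P}_B(A)\otimes\mathbb{P}(B)$.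
   Formalization: The axiom that no event is independent of itself is required only for events other than the empty set and Ω, since for A = Ω it contradicts the axiom that every event is independent of Ω. *)

theory Defs
  imports "HOL-Analysis.Analysis"
begin

text \<open>
  A metric partially ordered pseudo-semiring, carried by a whole type: addition and multiplication
  are \<open>+\<close> and \<open>*\<close>, the metric is \<^const>\<open>dist\<close>, and limits are taken in the induced topology.
  Neither \<open>0 * a = 0\<close> nor \<open>0 \<noteq> 1\<close> is assumed. Monotonicity of addition is inherited from
  \<^class>\<open>ordered_comm_monoid_add\<close>, distributivity from \<^class>\<open>comm_semiring\<close>.
\<close>

class metric_po_pseudo_semiring =
  comm_semiring + ordered_comm_monoid_add + comm_monoid_mult + metric_space +
  assumes mult_nonneg_left_mono: "0 \<le> a \<Longrightarrow> c \<le> b \<Longrightarrow> a * c \<le> a * b"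
    and limseq_le: "X \<longlonglongrightarrow> a \<Longrightarrow> Y \<longlonglongrightarrow> b \<Longrightarrow> (\<And>n. X n \<le> Y n) \<Longrightarrow> a \<le> b"
    and limseq_add: "X \<longlonglongrightarrow> a \<Longrightarrow> Y \<longlonglongrightarrow> b \<Longrightarrow> (\<lambda>n. X n + Y n) \<longlonglongrightarrow> a + b"
    and limseq_mult: "X \<longlonglongrightarrow> a \<Longrightarrow> Y \<longlonglongrightarrow> b \<Longrightarrow> (\<lambda>n. X n * Y n) \<longlonglongrightarrow> a * b"

text \<open>
  A measurable space with a complex of conditions. The exclusivity relation is \<^const>\<open>disjnt\<close>, so
  only the independence relation is a parameter; it is constrained on events only.

  Irreflexivity is required of the events other than \<open>{}\<close> and \<open>\<Omega>\<close>. Without this restriction the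
  axioms are contradictory: \<open>indep_space\<close> gives that \<open>\<Omega>\<close> is independent of itself, and with
  symmetry and closure under complements also that \<open>{}\<close> is.
\<close>

locale complex_of_conditions = sigma_algebra \<Omega> M
  for \<Omega> :: "'a set" and M :: "'a set set" +
  fixes indep :: "'a set \<Rightarrow> 'a set \<Rightarrow> bool"
  assumes indep_irrefl: "A \<in> M \<Longrightarrow> A \<noteq> {} \<Longrightarrow> A \<noteq> \<Omega> \<Longrightarrow> \<not> indep A A"
    and indep_sym: "A \<in> M \<Longrightarrow> B \<in> M \<Longrightarrow> indep A B \<longleftrightarrow> indep B A"
    and indep_space: "A \<in> M \<Longrightarrow> indep A \<Omega>"
    and indep_Un: "A \<in> M \<Longrightarrow> B \<in> M \<Longrightarrow> C \<in> M \<Longrightarrow> indep A C \<Longrightarrow> indep B C \<Longrightarrow> indep (A \<union> B) C"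
    and indep_Int: "A \<in> M \<Longrightarrow> B \<in> M \<Longrightarrow> C \<in> M \<Longrightarrow> indep A C \<Longrightarrow> indep B C \<Longrightarrow> indep (A \<inter> B) C"
    and indep_compl: "A \<in> M \<Longrightarrow> B \<in> M \<Longrightarrow> indep A B \<Longrightarrow> indep (\<Omega> - A) B"

definition mutually_indep :: "('a set \<Rightarrow> 'a set \<Rightarrow> bool) \<Rightarrow> 'a set \<Rightarrow> 'a set \<Rightarrow> bool" where
  "mutually_indep indep A B \<longleftrightarrow> A \<inter> B \<noteq> {} \<and> indep A B"

text \<open>
  Every member is mutually independent of every (finite or infinite) intersection of the others.
  ``Others'' refers to indices: a sequence may repeat \<open>\<Omega>\<close>, so finite independent collections are
  covered by padding with \<open>\<Omega>\<close>.
\<close>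

definition mutually_indep_seq :: "('a set \<Rightarrow> 'a set \<Rightarrow> bool) \<Rightarrow> (nat \<Rightarrow> 'a set) \<Rightarrow> bool" where
  "mutually_indep_seq indep X \<longleftrightarrow>
     (\<forall>i J. J \<noteq> {} \<longrightarrow> i \<notin> J \<longrightarrow> mutually_indep indep (X i) (\<Inter>j\<in>J. X j))"

locale abstract_prob_space = complex_of_conditions \<Omega> M indep
  for \<Omega> :: "'a set" and M :: "'a set set" and indep :: "'a set \<Rightarrow> 'a set \<Rightarrow> bool" +
  fixes P :: "'a set \<Rightarrow> 's::metric_po_pseudo_semiring"
  assumes P_range: "A \<in> M \<Longrightarrow> P A \<in> {0..1}"
    and P_empty: "P {} = 0"
    and P_mono: "A \<in> M \<Longrightarrow> B \<in> M \<Longrightarrow> A \<subseteq> B \<Longrightarrow> P A \<le> P B"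
    and P_Union: "range X \<subseteq> M \<Longrightarrow> disjoint_family X \<Longrightarrow> (\<lambda>i. P (X i)) sums P (\<Union>i. X i)"
    and P_space: "P \<Omega> = 1"
    and P_Inter: "range X \<subseteq> M \<Longrightarrow> mutually_indep_seq indep X \<Longrightarrow>
      (\<lambda>n. \<Prod>i<n. P (X i)) \<longlonglongrightarrow> P (\<Inter>i. X i)"

locale abstract_cond_prob =
  P: abstract_prob_space \<Omega> M indep P + Q: abstract_prob_space \<Omega> M indep Q
  for \<Omega> :: "'a set" and M :: "'a set set" and indep :: "'a set \<Rightarrow> 'a set \<Rightarrow> bool"
    and P :: "'a set \<Rightarrow> 's::metric_po_pseudo_semiring"
    and B :: "'a set" and Q :: "'a set \<Rightarrow> 's" +
  assumes cond_event: "B \<in> M" "P B \<noteq> 0"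
    and cond_exclusive: "A \<in> M \<Longrightarrow> disjnt A B \<Longrightarrow> Q A = 0"
    and cond_indep: "A \<in> M \<Longrightarrow> indep A B \<Longrightarrow> Q A = P A"
    and cond_dep: "A \<in> M \<Longrightarrow> \<not> indep A B \<Longrightarrow> Q A \<noteq> P A"
    and cond_Int: "A \<in> M \<Longrightarrow> P (A \<inter> B) = Q A * P B"

end

theory Submission
  imports Defs
begin

text \<open>The events \<open>A \<inter> H i\<close> partition \<open>A\<close>, since the
  \<open>H i\<close> partition \<open>\<Omega>\<close>. Finite additivity
  (\<open>P_finite_UN\<close>) splits \<open>P A\<close> over these pieces, and the product rule
  \<open>cond_Int\<close> together with commutativity of \<open>*\<close> turns each piece into
  \<open>P (H i) * PH i A\<close>. What needs proof is finite additivity, because the axioms give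
  additivity only for infinite sequences.\<close>

context abstract_prob_space
begin

text \<open>Countable additivity is applied to the sequence \<open>A, B, {}, {}, ...\<close>. As
  \<open>P {} = 0\<close>, its partial sums are constant from the second on, and limits in a metric
  space are unique.\<close>

lemma P_Un_disjoint:
  assumes "A \<in> M" "B \<in> M" "A \<inter> B = {}"
  shows "P (A \<union> B) = P A + P B"
proof -
  have "range (binaryset A B) \<subseteq> M"
    using assms by (simp add: range_binaryset_eq)
  moreover have "disjoint_family (binaryset A B)"
    using assms by (auto simp: disjoint_family_on_def binaryset_def)
  ultimately have "(\<lambda>i. P (binaryset A B i)) sums P (A \<union> B)"
    using P_Union by (metis UN_binaryset_eq)
  moreover have "(\<lambda>i. P (binaryset A B i)) sums (P A + P B)"
    using P_empty by (rule binaryset_sums)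
  ultimately show ?thesis
    by (rule sums_unique2)
qed

text \<open>Induction on \<open>I\<close> needs no enumeration of the index set: each new event is
  disjoint from the union of the earlier ones, so the case of two events suffices.\<close>

lemma P_finite_UN:
  assumes "finite I" "\<And>i. i \<in> I \<Longrightarrow> F i \<in> M" "disjoint_family_on F I"
  shows "P (\<Union>i\<in>I. F i) = (\<Sum>i\<in>I. P (F i))"
  using assms
proof (induction I rule: finite_induct)
  case empty
  then show ?case by (simp add: P_empty)
next
  case (insert i I)
  then have "F i \<inter> (\<Union>j\<in>I. F j) = {}" "disjoint_family_on F I"
    by (auto simp: disjoint_family_on_def)
  moreover have "(\<Union>j\<in>I. F j) \<in> M"
    using insert by (intro finite_UN) auto
  ultimately show ?case
    using insert by (simp add: P_Un_disjoint)
qed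

end

theorem theorem3p3:
  fixes \<Omega> :: "'a set" and M :: "'a set set" and indep :: "'a set \<Rightarrow> 'a set \<Rightarrow> bool"
    and P :: "'a set \<Rightarrow> 's::metric_po_pseudo_semiring"
    and A :: "'a set" and I :: "'i set" and H :: "'i \<Rightarrow> 'a set"
    and PH :: "'i \<Rightarrow> 'a set \<Rightarrow> 's"
  assumes "abstract_prob_space \<Omega> M indep P"
    and "A \<in> M"
    and "finite I"
    and "\<And>i. i \<in> I \<Longrightarrow> H i \<in> M"
    and "disjoint_family_on H I"
    and "(\<Union>i\<in>I. H i) = \<Omega>"
    and "\<And>i. i \<in> I \<Longrightarrow> P (H i) \<noteq> 0"
    and "\<And>i. i \<in> I \<Longrightarrow> abstract_cond_prob \<Omega> M indep P (H i) (PH i)"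
  shows "P A = (\<Sum>i\<in>I. P (H i) * PH i A)"
proof -
  interpret abstract_prob_space \<Omega> M indep P by fact
  have "A = (\<Union>i\<in>I. A \<inter> H i)"
    using assms(6) sets_into_space[OF assms(2)] by auto
  \<comment> \<open>\<open>A\<close> recurs on the right of the equation, so rewriting with it would
    loop; \<open>arg_cong\<close> applies \<open>P\<close> to both sides once.\<close>
  then have "P A = P (\<Union>i\<in>I. A \<inter> H i)"
    by (rule arg_cong)
  also have "\<dots> = (\<Sum>i\<in>I. P (A \<inter> H i))"
    using assms(2-5) by (intro P_finite_UN) (auto simp: disjoint_family_on_def)
  also have "\<dots> = (\<Sum>i\<in>I. P (H i) * PH i A)"
    using abstract_cond_prob.cond_Int[OF assms(8) assms(2)]
    by (intro sum.cong) (simp_all add: mult.commute)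
  finally show ?thesis .
qed

end
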